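(* Let $(X,X_+,\mathcal{K},f)$ be a strong abstract state space, and let $P$ be a Markov projection on $X$. Let $T:X\to X$ be a Markov operator with $PT=TP$ and $TP=P$. Then the following conditions are equivalent: (i) $T$ satisfies condition $\mathfrak{D}_P$: there exist a constant $\tau\in(0,1]$, an integer $n_0\in\mathbb{N}$ (with $n_0\geq1$) and a Markov projection $Q$ on $X$ with $Q=QP=PQ$ such that for every $x\in\mathcal{K}$ there exists $\varphi_x\in X_+$ with $$\sup_{x\in\mathcal{K}}\|\varphi_x\|\le\frac{\tau}{4}\qquad\text{and}\qquad T^{n_0}x+\varphi_x\ge\tau Qx\quad\text{for all }x\in\mathcal{K};$$ (ii) $T$ is uniformly $P$-ergodic, i.e. $\lim_{n\to\infty}\|T^n-P\|=0$.
   Context: Abstract state space: let $X\neq\{0\}$ be a real ordered vector space with cone $X_+=\{x\in X: x\ge 0\}$ which is generating ($X=X_+-X_+$), let $f$ be a strictly positive linear functional on $X$ ($f(x)>0$ for $x\ge 0$, $x\ne 0$), and let $\mathcal{K}=\{x\in X_+: f(x)=1\}$. Let $U$ be the convex hull of $\mathcal{K}\cup(-\mathcal{K})$ and $\|x\|=\inf\{\lambda\ge 0: x\in\lambda U\}$. $(X,X_+,\mathcal{K},f)$ is an abstract state space if this seminorm is a norm, $X$ is complete for it, and $X_+$ is closed. It is a strong abstract state space if in addition $U$ is radially compact, i.e. $\ell\cap U$ is a closed and bounded segment for every line $\ell$ through the origin; equivalently, $U$ coincides with the closed unit ball of $X$. A Markov operator on $X$ is a linear operator $T:X\to X$ that is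 positive ($Tx\ge0$ for $x\ge0$) and satisfies $T(\mathcal{K})\subset\mathcal{K}$. A Markov projection is a Markov operator $P$ with $P^2=P$. *)

theory Defs
  imports "HOL-Analysis.Analysis"
begin

text \<open>The cone of an ordered vector space \<open>'a\<close> is \<open>{x. 0 \<le> x}\<close>; the order is that of
  class \<^class>\<open>ordered_real_vector\<close>.\<close>

definition state_base :: "('a::ordered_real_vector \<Rightarrow> real) \<Rightarrow> 'a set"
  where "state_base f = {x. 0 \<le> x \<and> f x = 1}"

definition state_unit_set :: "('a::ordered_real_vector \<Rightarrow> real) \<Rightarrow> 'a set"
  where "state_unit_set f = convex hull (state_base f \<union> uminus ` state_base f)"

definition state_seminorm :: "('a::ordered_real_vector \<Rightarrow> real) \<Rightarrow> 'a \<Rightarrow> real"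
  where "state_seminorm f x = Inf {l. 0 \<le> l \<and> x \<in> (\<lambda>u. l *\<^sub>R u) ` state_unit_set f}"

text \<open>Requiring that the norm of the type is the gauge of the unit set says that the gauge is a
  norm; completeness of the space for it is then the class \<^class>\<open>banach\<close>, and \<^const>\<open>closed\<close>,
  limits and operator norms all refer to it.\<close>

locale abstract_state_space =
  fixes f :: "'a::{banach, ordered_real_vector} \<Rightarrow> real"
  assumes nontrivial: "\<exists>x::'a. x \<noteq> 0"
    and generating: "\<And>x::'a. \<exists>y z. 0 \<le> y \<and> 0 \<le> z \<and> x = y - z"
    and linear_functional: "linear f"
    and strictly_positive: "\<And>x. 0 \<le> x \<Longrightarrow> x \<noteq> 0 \<Longrightarrow> 0 < f x"
    and norm_eq_seminorm: "\<And>x. norm x = state_seminorm f x"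
    and closed_cone: "closed {x::'a. 0 \<le> x}"

definition radially_compact :: "'a::real_vector set \<Rightarrow> bool"
  where "radially_compact U \<longleftrightarrow>
    (\<forall>v. v \<noteq> 0 \<longrightarrow> (\<exists>a b. range (\<lambda>t. t *\<^sub>R v) \<inter> U = closed_segment a b))"

locale strong_abstract_state_space = abstract_state_space +
  assumes radially_compact: "radially_compact (state_unit_set f)"

definition markov_operator ::
    "('a::ordered_real_vector \<Rightarrow> real) \<Rightarrow> ('a \<Rightarrow> 'a) \<Rightarrow> bool"
  where "markov_operator f T \<longleftrightarrow>
    linear T \<and> (\<forall>x\<ge>0. 0 \<le> T x) \<and> T ` state_base f \<subseteq> state_base f"

definition markov_projection ::
    "('a::ordered_real_vector \<Rightarrow> real) \<Rightarrow> ('a \<Rightarrow> 'a) \<Rightarrow> bool"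
  where "markov_projection f P \<longleftrightarrow> markov_operator f P \<and> P \<circ> P = P"

text \<open>The \<^const>\<open>bdd_above\<close> conjunct is there because a real supremum is unspecified on unbounded
  sets.\<close>

definition condition_D ::
    "('a::{banach, ordered_real_vector} \<Rightarrow> real) \<Rightarrow> ('a \<Rightarrow> 'a) \<Rightarrow> ('a \<Rightarrow> 'a) \<Rightarrow> bool"
  where "condition_D f P T \<longleftrightarrow>
    (\<exists>(\<tau>::real) (n\<^sub>0::nat) Q. 0 < \<tau> \<and> \<tau> \<le> 1 \<and> 1 \<le> n\<^sub>0 \<and>
      markov_projection f Q \<and> Q = Q \<circ> P \<and> Q = P \<circ> Q \<and>
      (\<exists>\<phi>::'a \<Rightarrow> 'a. (\<forall>x\<in>state_base f. 0 \<le> \<phi> x) \<and>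
        bdd_above ((\<lambda>x. norm (\<phi> x)) ` state_base f) \<and>
        (SUP x\<in>state_base f. norm (\<phi> x)) \<le> \<tau> / 4 \<and>
        (\<forall>x\<in>state_base f. \<tau> *\<^sub>R Q x \<le> (T ^^ n\<^sub>0) x + \<phi> x)))"

text \<open>Markov operators on an abstract state space are bounded, so \<^const>\<open>onorm\<close> is the operator
  norm here.\<close>

definition uniformly_ergodic :: "('a::real_normed_vector \<Rightarrow> 'a) \<Rightarrow> ('a \<Rightarrow> 'a) \<Rightarrow> bool"
  where "uniformly_ergodic P T \<longleftrightarrow> (\<lambda>n. onorm (\<lambda>x. (T ^^ n) x - P x)) \<longlonglongrightarrow> 0"

end

theory Submission imports Defs begin

text \<open>Elements of the open ball of radius \<open>l\<close> split as \<open>a - b\<close> with \<open>a, b \<ge> 0\<close> and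
  \<open>f a + f b < l\<close>, and the norm equals \<open>f\<close> on the cone. Given condition \<open>\<DD>\<^sub>P\<close>, split an element
  \<open>y\<close> of the kernel of \<open>P\<close> in this way. Since \<open>Q = Q P\<close>, the lower bounds \<open>\<tau> Q a\<close> and \<open>\<tau> Q b\<close>
  coincide and cancel in \<open>T\<^sup>n y\<close> with \<open>n = n\<^sub>0\<close>, so \<open>T\<^sup>n\<close> contracts the kernel by the factor
  \<open>1 - \<tau>/2\<close>; as \<open>T\<^sup>n - P = T\<^sup>n (1 - P)\<close>, uniform ergodicity follows. Conversely, once
  \<open>\<parallel>T\<^sup>n - P\<parallel> < 1/4\<close>, the negative part of \<open>T\<^sup>n x - P x\<close> serves as \<open>\<phi>\<^sub>x\<close>, with \<open>Q = P\<close> and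
  \<open>\<tau> = 1\<close>.\<close>

context abstract_state_space
begin

section \<open>The base norm and decompositions along the cone\<close>

lemma f_nonneg: "0 \<le> x \<Longrightarrow> 0 \<le> f x"
  using strictly_positive[of x] linear_0[OF linear_functional] by (cases "x = 0") auto

lemma normalize_in_state_base:
  assumes "0 \<le> x" "x \<noteq> 0"
  shows "(1 / f x) *\<^sub>R x \<in> state_base f"
  using strictly_positive[OF assms] assms(1)
  by (simp add: state_base_def linear_scale[OF linear_functional] scaleR_nonneg_nonneg)

lemma state_base_nonempty: "state_base f \<noteq> {}"
proof -
  obtain x :: 'a where "x \<noteq> 0" using nontrivial by blast
  moreover obtain y z where "0 \<le> y" "0 \<le> z" "x = y - z" using generating by blast
  ultimately have "y \<noteq> 0 \<or> z \<noteq> 0" by auto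
  then show ?thesis using normalize_in_state_base \<open>0 \<le> y\<close> \<open>0 \<le> z\<close> by blast
qed

text \<open>The differences \<open>a - b\<close> of total mass 1 form a convex set containing the
  base and its negative, hence also the convex hull of their union.\<close>

lemma state_unit_set_decompose:
  assumes "u \<in> state_unit_set f"
  obtains a b where "0 \<le> a" "0 \<le> b" "u = a - b" "f a + f b = 1"
proof -
  let ?S = "{u. \<exists>a b. 0 \<le> a \<and> 0 \<le> b \<and> u = a - b \<and> f a + f b = 1}"
  note f = linear_add[OF linear_functional] linear_scale[OF linear_functional]
  have "convex ?S"
  proof (rule convexI)
    fix x y and s t :: real
    assume "x \<in> ?S" "y \<in> ?S" and st: "0 \<le> s" "0 \<le> t" "s + t = 1"
    then obtain a b c d where "0 \<le> a" "0 \<le> b" "x = a - b" "f a + f b = 1"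
      "0 \<le> c" "0 \<le> d" "y = c - d" "f c + f d = 1" by auto
    then have "0 \<le> s *\<^sub>R a + t *\<^sub>R c" "0 \<le> s *\<^sub>R b + t *\<^sub>R d"
      "s *\<^sub>R x + t *\<^sub>R y = (s *\<^sub>R a + t *\<^sub>R c) - (s *\<^sub>R b + t *\<^sub>R d)"
      using st by (auto simp: scaleR_nonneg_nonneg algebra_simps)
    moreover have "f (s *\<^sub>R a + t *\<^sub>R c) + f (s *\<^sub>R b + t *\<^sub>R d)
        = s * (f a + f b) + t * (f c + f d)"
      by (simp add: f algebra_simps)
    then have "f (s *\<^sub>R a + t *\<^sub>R c) + f (s *\<^sub>R b + t *\<^sub>R d) = 1"
      using \<open>f a + f b = 1\<close> \<open>f c + f d = 1\<close> st by simp
    ultimately show "s *\<^sub>R x + t *\<^sub>R y \<in> ?S" by blast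
  qed
  moreover have "state_base f \<union> uminus ` state_base f \<subseteq> ?S"
  proof
    fix x assume "x \<in> state_base f \<union> uminus ` state_base f"
    then obtain y where y: "0 \<le> y" "f y = 1" "x = y - 0 \<or> x = 0 - y"
      by (auto simp: state_base_def)
    moreover have "f y + f 0 = 1" "f 0 + f y = 1"
      using y(2) linear_0[OF linear_functional] by auto
    ultimately show "x \<in> ?S" by blast
  qed
  ultimately have "state_unit_set f \<subseteq> ?S"
    unfolding state_unit_set_def by (simp add: hull_minimal)
  then show ?thesis using assms that by auto
qed

text \<open>The normalized vector lies in the base, so \<open>f x\<close> competes in the infimum
  defining the norm.\<close>

lemma norm_le_f:
  assumes "0 \<le> x"
  shows "norm x \<le> f x"
proof (cases "x = 0")
  case True
  then show ?thesis using linear_0[OF linear_functional] by simp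
next
  case False
  have "(1 / f x) *\<^sub>R x \<in> state_unit_set f"
    unfolding state_unit_set_def
    using normalize_in_state_base[OF assms False] by (simp add: hull_inc)
  then have "f x *\<^sub>R ((1 / f x) *\<^sub>R x) \<in> (\<lambda>u. f x *\<^sub>R u) ` state_unit_set f" by blast
  then have "x \<in> (\<lambda>u. f x *\<^sub>R u) ` state_unit_set f"
    using strictly_positive[OF assms False] by simp
  then show ?thesis
    unfolding norm_eq_seminorm state_seminorm_def
    using f_nonneg[OF assms] by (intro cInf_lower bdd_belowI[of _ 0]) auto
qed

lemma norm_diff_le:
  assumes "0 \<le> a" "0 \<le> b"
  shows "norm (a - b) \<le> f a + f b"
  using norm_triangle_ineq4[of a b] norm_le_f[OF assms(1)] norm_le_f[OF assms(2)] by linarith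

text \<open>A real infimum carries information only over a nonempty set. The unit set absorbs every
  vector because the cone is generating.\<close>

lemma gauge_set_nonempty: "{l. 0 \<le> l \<and> x \<in> (\<lambda>u. l *\<^sub>R u) ` state_unit_set f} \<noteq> {}"
proof (cases "x = 0")
  case True
  obtain k where "k \<in> state_unit_set f"
    using state_base_nonempty hull_subset unfolding state_unit_set_def by fastforce
  then have "0 \<in> (\<lambda>u. 0 *\<^sub>R u) ` state_unit_set f" by auto
  then show ?thesis using True by blast
next
  case False
  obtain a b where ab: "0 \<le> a" "0 \<le> b" "x = a - b" using generating by blast
  let ?m = "f a + f b"
  have cv: "convex (state_unit_set f)" by (simp add: state_unit_set_def)
  \<comment> \<open>For \<open>c = 0\<close> any base point serves as \<open>k\<close>, since
    \<open>f 0 = 0\<close>.\<close>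
  have "\<exists>k \<in> state_unit_set f. -k \<in> state_unit_set f \<and> c = f c *\<^sub>R k" if "0 \<le> c" for c
  proof (cases "c = 0")
    case True
    obtain k where "k \<in> state_base f" using state_base_nonempty by blast
    then show ?thesis using True linear_0[OF linear_functional]
      by (auto simp: state_unit_set_def intro!: bexI[of _ k] hull_inc)
  next
    case False
    then show ?thesis using normalize_in_state_base[OF that False] strictly_positive[OF that False]
      by (auto simp: state_unit_set_def intro!: bexI[of _ "(1 / f c) *\<^sub>R c"] hull_inc)
  qed
  then obtain k k' where k: "k \<in> state_unit_set f" "a = f a *\<^sub>R k"
      and k': "-k' \<in> state_unit_set f" "b = f b *\<^sub>R k'" using ab by blast
  have "0 < ?m"
    using ab False f_nonneg strictly_positive by (metis add_nonneg_pos add_pos_nonneg diff_self)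
  \<comment> \<open>The masses of \<open>a\<close> and \<open>b\<close>, divided by the total mass
    \<open>?m\<close>, are the convex weights.\<close>
  have "(f a / ?m) *\<^sub>R k + (f b / ?m) *\<^sub>R (- k') \<in> state_unit_set f"
    using convexD[OF cv k(1) k'(1), of "f a / ?m" "f b / ?m"] \<open>0 < ?m\<close> f_nonneg ab
    by (simp add: add_divide_distrib[symmetric])
  moreover have "x = ?m *\<^sub>R ((f a / ?m) *\<^sub>R k + (f b / ?m) *\<^sub>R (- k'))"
    using \<open>0 < ?m\<close> ab(3) k(2) k'(2) by (simp add: scaleR_diff_right)
  ultimately have "x \<in> (\<lambda>u. ?m *\<^sub>R u) ` state_unit_set f" by (rule image_eqI[rotated])
  then show ?thesis using \<open>0 < ?m\<close> by (blast intro: less_imp_le)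
qed

text \<open>The strict bound lets a competitor \<open>m < l\<close> be picked from the infimum
  without assuming it is attained; scaling a decomposition of mass 1 by \<open>m\<close> does the
  rest.\<close>

lemma norm_less_decompose:
  assumes "norm x < l"
  obtains a b where "0 \<le> a" "0 \<le> b" "x = a - b" "f a + f b < l"
proof -
  have "Inf {l. 0 \<le> l \<and> x \<in> (\<lambda>u. l *\<^sub>R u) ` state_unit_set f} < l"
    using assms by (simp add: norm_eq_seminorm state_seminorm_def)
  from cInf_lessD[OF gauge_set_nonempty this] obtain m u
    where m: "0 \<le> m" "m < l" and u: "u \<in> state_unit_set f" "x = m *\<^sub>R u" by auto
  obtain a b where "0 \<le> a" "0 \<le> b" "u = a - b" and 1: "f a + f b = 1"
    using state_unit_set_decompose[OF u(1)] .
  moreover have "f (m *\<^sub>R a) + f (m *\<^sub>R b) = m * (f a + f b)"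
    by (simp add: linear_scale[OF linear_functional] algebra_simps)
  ultimately show ?thesis
    using m u by (intro that[of "m *\<^sub>R a" "m *\<^sub>R b"])
      (auto simp: scaleR_nonneg_nonneg scaleR_diff_right)
qed

text \<open>A decomposition gives \<open>f x = f a - f b \<le> f a + f b < l\<close>. With
  \<open>norm_le_f\<close>, norm and \<open>f\<close> agree on the cone.\<close>

lemma f_le_norm: "f x \<le> norm x"
proof (rule dense_ge)
  fix l assume "norm x < l"
  then obtain a b where "0 \<le> a" "0 \<le> b" "x = a - b" "f a + f b < l"
    by (rule norm_less_decompose)
  then show "f x \<le> l"
    using f_nonneg[of b] linear_diff[OF linear_functional, of a b] by simp
qed

section \<open>Markov operators: conservation of mass and contractivity\<close>

lemma markov_operatorD:
  assumes "markov_operator f T"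
  shows "linear T" and "0 \<le> x \<Longrightarrow> 0 \<le> T x" and "f (T x) = f x"
proof -
  show lin: "linear T" using assms by (simp add: markov_operator_def)
  show "0 \<le> x \<Longrightarrow> 0 \<le> T x" using assms by (simp add: markov_operator_def)
  have pos: "f (T x) = f x" if "0 \<le> x" for x
  proof (cases "x = 0")
    case True
    then show ?thesis using linear_0[OF lin] by simp
  next
    case False
    have "T ((1 / f x) *\<^sub>R x) \<in> state_base f"
      using assms normalize_in_state_base[OF that False] by (auto simp: markov_operator_def)
    then show ?thesis using strictly_positive[OF that False]
      by (simp add: state_base_def linear_scale[OF lin] linear_scale[OF linear_functional]
          field_simps)
  qed
  \<comment> \<open>Mass conservation passes from the cone to all of the space because the cone is
    generating.\<close>
  obtain y z where "0 \<le> y" "0 \<le> z" "x = y - z" using generating by blast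
  then show "f (T x) = f x"
    by (simp add: linear_diff[OF lin] linear_diff[OF linear_functional] pos)
qed

text \<open>By positivity and conservation of \<open>f\<close>, the image of a decomposition is a
  decomposition of the image with the same total mass.\<close>

lemma markov_operator_norm_le:
  assumes "markov_operator f T"
  shows "norm (T x) \<le> norm x"
proof (rule dense_ge)
  fix l assume "norm x < l"
  then obtain a b where "0 \<le> a" "0 \<le> b" "x = a - b" "f a + f b < l"
    by (rule norm_less_decompose)
  then show "norm (T x) \<le> l"
    using norm_diff_le[of "T a" "T b"] markov_operatorD[OF assms]
    by (simp add: linear_diff)
qed

lemma markov_operator_funpow:
  assumes "markov_operator f T"
  shows "markov_operator f (T ^^ n)"
proof (induction n)
  case 0
  then show ?case by (simp add: markov_operator_def linear_ident)
next
  case (Suc n)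
  then show ?case using assms
    by (auto simp: markov_operator_def image_subset_iff comp_def
        intro: linear_compose[unfolded comp_def])
qed

lemma markov_operator_bounded_linear:
  assumes "markov_operator f T"
  shows "bounded_linear T"
  using markov_operatorD(1)[OF assms] markov_operator_norm_le[OF assms]
  by (intro bounded_linear_intro[of T 1]) (auto simp: linear_add linear_scale)

section \<open>Contraction on the kernel of the projection\<close>

lemma condition_D_contraction:
  assumes S: "markov_operator f S" and Q: "markov_operator f Q"
    and \<tau>: "0 < \<tau>"
    and \<phi>: "\<And>x. x \<in> state_base f \<Longrightarrow> 0 \<le> \<phi> x"
      "\<And>x. x \<in> state_base f \<Longrightarrow> norm (\<phi> x) \<le> \<tau> / 4"
      "\<And>x. x \<in> state_base f \<Longrightarrow> \<tau> *\<^sub>R Q x \<le> S x + \<phi> x"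
    and y: "Q y = 0"
  shows "norm (S y) \<le> (1 - \<tau> / 2) * norm y"
proof -
  note f = linear_add[OF linear_functional] linear_diff[OF linear_functional]
    linear_scale[OF linear_functional]
  have base: "norm (S u - S v) \<le> 2 - \<tau>"
    if uv: "u \<in> state_base f" "v \<in> state_base f" and "Q u = Q v" for u v
  proof -
    \<comment> \<open>\<open>r x\<close> is the positive remainder above the lower bound. When
      \<open>Q u = Q v\<close>, that bound cancels in \<open>S u - S v\<close>, leaving only
      remainders and corrections.\<close>
    define r where "r x = S x + \<phi> x - \<tau> *\<^sub>R Q x" for x
    have r: "0 \<le> r x" "f (r x) \<le> 1 - \<tau> + f (\<phi> x)" "f (\<phi> x) \<le> \<tau> / 4"
      if "x \<in> state_base f" for x
      using \<phi>(2,3)[OF that] that f_le_norm[of "\<phi> x"]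
      by (auto simp: r_def f state_base_def markov_operatorD(3)[OF S] markov_operatorD(3)[OF Q])
    have "S u - S v = (r u + \<phi> v) - (r v + \<phi> u)"
      using \<open>Q u = Q v\<close> by (simp add: r_def)
    then have "norm (S u - S v) \<le> f (r u + \<phi> v) + f (r v + \<phi> u)"
      using norm_diff_le[of "r u + \<phi> v" "r v + \<phi> u"] r(1) \<phi>(1) uv by simp
    \<comment> \<open>Each remainder has mass at most \<open>1 - \<tau> + \<tau> / 4\<close>, and
      each of the two further corrections at most \<open>\<tau> / 4\<close>: four quarters give back
      one of the two lost \<open>\<tau>\<close>.\<close>
    also have "\<dots> \<le> 2 - \<tau>"
      using r(2,3)[OF uv(1)] r(2,3)[OF uv(2)] by (simp add: f)
    finally show ?thesis .
  qed
  \<comment> \<open>Taking \<open>u = v\<close> in \<open>base\<close> gives this, so the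
    contraction factor is nonnegative.\<close>
  have "\<tau> \<le> 2"
    using base state_base_nonempty by force
  have step: "norm (S y) \<le> (1 - \<tau> / 2) * l" if yl: "norm y < l" for l
  proof -
    obtain a b where ab: "0 \<le> a" "0 \<le> b" "y = a - b" "f a + f b < l"
      using yl by (rule norm_less_decompose)
    \<comment> \<open>\<open>Q\<close> conserves mass, so \<open>y\<close> has mass zero; thus
      \<open>a\<close> and \<open>b\<close> have equal mass and one scalar normalizes both.\<close>
    have "f y = 0"
      using markov_operatorD(3)[OF Q, of y] y linear_0[OF linear_functional] by simp
    then have eq: "f a = f b" by (simp add: ab f)
    show ?thesis
    proof (cases "a = 0 \<or> b = 0")
      case True
      then have "f a = 0" "f b = 0" using eq linear_0[OF linear_functional] by auto
      then have "y = 0" using ab strictly_positive by (metis diff_self less_irrefl)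
      then show ?thesis using yl \<open>\<tau> \<le> 2\<close> linear_0[OF markov_operatorD(1)[OF S]] by simp
    next
      case False
      let ?u = "(1 / f a) *\<^sub>R a" and ?v = "(1 / f a) *\<^sub>R b"
      have u: "?u \<in> state_base f" and v: "?v \<in> state_base f"
        using normalize_in_state_base ab False eq by (blast, metis)
      have s: "0 < f a" using False strictly_positive ab by blast
      note lin = markov_operatorD(1)[OF S] markov_operatorD(1)[OF Q]
      have "Q a = Q b" using y ab linear_diff[OF lin(2)] by simp
      then have "Q ?u = Q ?v" by (simp add: linear_scale[OF lin(2)])
      then have *: "norm (S ?u - S ?v) \<le> 2 - \<tau>" using base u v by blast
      have "S y = f a *\<^sub>R (S ?u - S ?v)"
        using s by (simp add: ab linear_scale[OF lin(1)] linear_diff[OF lin(1)] scaleR_diff_right)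
      then have "norm (S y) \<le> f a * (2 - \<tau>)"
        using * s by (simp add: mult_left_mono)
      \<comment> \<open>Equal masses with sum below \<open>l\<close> are each below
        \<open>l / 2\<close>.\<close>
      also have "\<dots> \<le> (l / 2) * (2 - \<tau>)"
        using ab(4) eq \<open>\<tau> \<le> 2\<close> by (intro mult_right_mono) auto
      finally show ?thesis by (simp add: algebra_simps)
    qed
  qed
  \<comment> \<open>Letting \<open>l\<close> decrease to \<open>norm y\<close> removes the slack of
    the strict decomposition.\<close>
  have "((\<lambda>l. (1 - \<tau> / 2) * l) \<longlongrightarrow> (1 - \<tau> / 2) * norm y) (at_right (norm y))"
    by (intro tendsto_intros)
  then show ?thesis
    by (rule tendsto_lowerbound)
      (auto simp: step eventually_at_filter)
qed

end

section \<open>From the lower bound condition to uniform ergodicity\<close>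

lemma condition_D_imp_uniformly_ergodic:
  assumes "abstract_state_space f" and P: "markov_projection f P" and T: "markov_operator f T"
    and comm: "P \<circ> T = T \<circ> P" and TP: "T \<circ> P = P" and D: "condition_D f P T"
  shows "uniformly_ergodic P T"
proof -
  interpret abstract_state_space f by fact
  obtain \<tau> :: real and N Q \<phi> where \<tau>: "0 < \<tau>" "\<tau> \<le> 1" and N: "1 \<le> N"
    and Q: "markov_projection f Q" "Q = Q \<circ> P"
    and \<phi>: "\<forall>x\<in>state_base f. 0 \<le> \<phi> x" "bdd_above ((\<lambda>x. norm (\<phi> x)) ` state_base f)"
      "(SUP x\<in>state_base f. norm (\<phi> x)) \<le> \<tau> / 4"
      "\<forall>x\<in>state_base f. \<tau> *\<^sub>R Q x \<le> (T ^^ N) x + \<phi> x"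
    using D unfolding condition_D_def by blast
  have Pm: "markov_operator f P" and PP: "\<And>x. P (P x) = P x"
    and Qm: "markov_operator f Q" and QP: "\<And>x. Q x = Q (P x)"
    using P Q unfolding markov_projection_def by (auto dest: fun_cong)
  have \<phi>_le: "norm (\<phi> x) \<le> \<tau> / 4" if "x \<in> state_base f" for x
    using cSUP_upper[OF that \<phi>(2)] \<phi>(3) by linarith
  have contr: "norm ((T ^^ N) y) \<le> (1 - \<tau> / 2) * norm y" if "P y = 0" for y
    using that \<phi> \<phi>_le QP[of y] linear_0[OF markov_operatorD(1)[OF Qm]] \<tau>(1)
    by (intro condition_D_contraction[OF markov_operator_funpow[OF T] Qm, of \<tau> \<phi>]) auto
  \<comment> \<open>Commutation keeps orbits in the kernel of \<open>P\<close>, so the contraction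
    can be iterated.\<close>
  have ker: "P ((T ^^ n) y) = 0" if "P y = 0" for n y
  proof (induction n)
    case (Suc n)
    then show ?case
      using fun_cong[OF comm, of "(T ^^ n) y"] linear_0[OF markov_operatorD(1)[OF T]] by simp
  qed (use that in simp)
  have iter: "norm ((T ^^ (k * N)) y) \<le> (1 - \<tau> / 2) ^ k * norm y" if "P y = 0" for k y
  proof (induction k)
    case (Suc k)
    have "norm ((T ^^ (Suc k * N)) y) \<le> (1 - \<tau> / 2) * norm ((T ^^ (k * N)) y)"
      using contr[OF ker[OF that]] by (simp add: funpow_add)
    also have "\<dots> \<le> (1 - \<tau> / 2) * ((1 - \<tau> / 2) ^ k * norm y)"
      using Suc \<tau> by (intro mult_left_mono) auto
    finally show ?case by (simp add: mult.assoc)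
  qed simp
  have TnP: "(T ^^ n) (P x) = P x" for n x
    by (induction n) (use fun_cong[OF TP] in auto)
  \<comment> \<open>Full blocks of length \<open>N\<close> contract \<open>x - P x\<close>, whose
    norm is at most \<open>2 * norm x\<close>; the \<open>n mod N\<close> leftover steps do not
    increase the norm. The resulting decay is geometric.\<close>
  have bound: "norm ((T ^^ n) x - P x) \<le> (2 * (1 - \<tau> / 2) ^ (n div N)) * norm x" for n x
  proof -
    let ?y = "x - P x" and ?k = "n div N"
    have ky: "P ?y = 0" by (simp add: linear_diff[OF markov_operatorD(1)[OF Pm]] PP)
    have "(T ^^ n) x - P x = (T ^^ n) ?y"
      by (simp add: linear_diff[OF markov_operatorD(1)[OF markov_operator_funpow[OF T]]] TnP)
    also have "\<dots> = (T ^^ (n mod N)) ((T ^^ (?k * N)) ?y)"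
      by (metis comp_apply funpow_add mod_div_mult_eq)
    also have "norm \<dots> \<le> norm ((T ^^ (?k * N)) ?y)"
      using markov_operator_norm_le[OF markov_operator_funpow[OF T]] .
    also have "\<dots> \<le> (1 - \<tau> / 2) ^ ?k * norm ?y" using iter[OF ky] .
    also have "\<dots> \<le> (1 - \<tau> / 2) ^ ?k * (2 * norm x)"
      using norm_triangle_ineq4[of x "P x"] markov_operator_norm_le[OF Pm, of x] \<tau>
      by (intro mult_left_mono) auto
    finally show ?thesis by (simp add: algebra_simps)
  qed
  have "filterlim (\<lambda>n. n div N) at_top sequentially"
    using N by (simp add: filterlim_at_top_div_const_nat)
  then have "(\<lambda>n. (1 - \<tau> / 2) ^ (n div N)) \<longlonglongrightarrow> 0"
    using \<tau> by (intro filterlim_compose[OF LIMSEQ_realpow_zero]) auto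
  then have "(\<lambda>n. 2 * (1 - \<tau> / 2) ^ (n div N)) \<longlonglongrightarrow> 0"
    using tendsto_mult_right_zero by blast
  moreover have "norm (onorm (\<lambda>x. (T ^^ n) x - P x)) \<le> 2 * (1 - \<tau> / 2) ^ (n div N)" for n
  proof -
    have "bounded_linear (\<lambda>x. (T ^^ n) x - P x)"
      by (intro bounded_linear_sub markov_operator_bounded_linear markov_operator_funpow T Pm)
    then show ?thesis
      using onorm_bound[OF _ bound, of n] onorm_pos_le \<tau> by fastforce
  qed
  ultimately show ?thesis
    unfolding uniformly_ergodic_def by (metis (no_types, lifting) Lim_null_comparison always_eventually)
qed

section \<open>From uniform ergodicity to the lower bound condition\<close>

lemma uniformly_ergodic_imp_condition_D:
  assumes "abstract_state_space f" and P: "markov_projection f P" and T: "markov_operator f T"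
    and E: "uniformly_ergodic P T"
  shows "condition_D f P T"
proof -
  interpret abstract_state_space f by fact
  have Pm: "markov_operator f P" and PP: "P \<circ> P = P"
    using P by (auto simp: markov_projection_def)
  have "eventually (\<lambda>n. onorm (\<lambda>x. (T ^^ n) x - P x) < 1 / 4) sequentially"
    using E unfolding uniformly_ergodic_def by (rule order_tendstoD) simp
  then obtain M where M: "\<And>n. n \<ge> M \<Longrightarrow> onorm (\<lambda>x. (T ^^ n) x - P x) < 1 / 4"
    by (auto simp: eventually_sequentially)
  \<comment> \<open>The successor guarantees the required exponent of at least 1, even when
    \<open>M = 0\<close>.\<close>
  define n where "n = Suc M"
  have "bounded_linear (\<lambda>x. (T ^^ n) x - P x)"
    by (intro bounded_linear_sub markov_operator_bounded_linear markov_operator_funpow T Pm)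
  from onorm[OF this]
  have le: "norm ((T ^^ n) x - P x) \<le> onorm (\<lambda>x. (T ^^ n) x - P x) * norm x" for x .
  have "\<exists>b. 0 \<le> b \<and> norm b \<le> 1 / 4 \<and> P x \<le> (T ^^ n) x + b" if "x \<in> state_base f" for x
  proof -
    have "norm x \<le> 1" using that norm_le_f[of x] by (auto simp: state_base_def)
    have "norm ((T ^^ n) x - P x) < 1 / 4"
    proof -
      have "onorm (\<lambda>x. (T ^^ n) x - P x) * norm x \<le> onorm (\<lambda>x. (T ^^ n) x - P x)"
        using \<open>norm x \<le> 1\<close> onorm_pos_le[OF \<open>bounded_linear _\<close>] by (simp add: mult_left_le)
      then show ?thesis using le[of x] M[of n] by (simp add: n_def)
    qed
    then obtain a b where ab: "0 \<le> a" "0 \<le> b" "(T ^^ n) x - P x = a - b" "f a + f b < 1 / 4"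
      by (rule norm_less_decompose)
    \<comment> \<open>Adding the subtracted part \<open>b\<close> leaves \<open>P x\<close> plus the
      positive \<open>a\<close>, and the norm of \<open>b\<close> is at most its mass, below
      \<open>1 / 4\<close>.\<close>
    have "(T ^^ n) x + b = P x + a" using ab(3) by (simp add: algebra_simps)
    then show ?thesis using ab f_nonneg[of a] norm_le_f[of b] by (intro exI[of _ b]) auto
  qed
  then obtain \<phi> where \<phi>: "\<forall>x\<in>state_base f. 0 \<le> \<phi> x \<and> norm (\<phi> x) \<le> 1 / 4 \<and>
      P x \<le> (T ^^ n) x + \<phi> x" by metis
  then have "bdd_above ((\<lambda>x. norm (\<phi> x)) ` state_base f)"
    by (intro bdd_aboveI[of _ "1 / 4"]) auto
  moreover have "(SUP x\<in>state_base f. norm (\<phi> x)) \<le> 1 / 4"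
    using \<phi> state_base_nonempty by (intro cSUP_least) auto
  ultimately show ?thesis
    unfolding condition_D_def using \<phi> P PP
    by (intro exI[of _ 1] exI[of _ n] exI[of _ P] conjI exI[of _ \<phi>]) (auto simp: n_def)
qed

theorem theorem4p1:
  fixes f :: "'a::{banach, ordered_real_vector} \<Rightarrow> real"
    and P T :: "'a \<Rightarrow> 'a"
  assumes "strong_abstract_state_space f"
    and "markov_projection f P"
    and "markov_operator f T"
    and "P \<circ> T = T \<circ> P"
    and "T \<circ> P = P"
  shows "condition_D f P T \<longleftrightarrow> uniformly_ergodic P T"
  using condition_D_imp_uniformly_ergodic[OF strong_abstract_state_space.axioms(1)] assms
    uniformly_ergodic_imp_condition_D[OF strong_abstract_state_space.axioms(1)] by blast

end
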